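(* The LREE scheme described in the context is positivity and trace preserving: for $n=0,\ldots,N-1$, the matrix $\varrho_{n+1}=Z_{n+1}Z_{n+1}^{\dagger}$ is Hermitian and positive semidefinite, and $$\|\varrho_{n+1}\|_1=\mathrm{Tr}(\varrho_{n+1})=1 .$$
   Context: $m,K,N,r_0$ are positive integers, $T>0$, $\tau=T/N$. $H\in\mathbb{C}^{m\times m}$ is Hermitian; $L_1,\dots,L_K\in\mathbb{C}^{m\times m}$ are arbitrary; $\gamma_1,\dots,\gamma_K\ge0$ are real; $\dagger$ is the conjugate transpose; $A=-iH-\frac12\sum_{k=1}^K\gamma_kL_k^{\dagger}L_k$. $\|\cdot\|_1$ is the trace (Schatten-1) norm (sum of the singular values), $\|\cdot\|_F$ the Frobenius norm. $\mathfrak{e}^{\tau A}\in\mathbb{C}^{m\times m}$ denotes an approximation of the matrix exponential $e^{\tau A}$. Column compression: for $tol_2>0$ and $Z\in\mathbb{C}^{m\times q}$ with singular values $\sigma_1(Z)\ge\sigma_2(Z)\ge\cdots$ (set to $0$ beyond index $\min(m,q)$), let $r$ be the minimal integer with $\sum_{j=r+1}^q\sigma_j^2(Z)\le tol_2$. Then $\mathcal{T}_{tol_2}(Z)$ is the best rank-$r$ approximation of $Z$ in Frobenius norm obtained by truncating a singular value decomposition $Z=\sum_j\sigma_ju_jv_j^{\dagger}$ to its first $r$ terms; it may be stored equivalently by the columns $\sigma_ju_j$, $j\le r$. LREE (low-rank exponential Euler) scheme: starting from $Z_0\in\mathbb{C}^{m\times r_0}$ with $\mathrm{Tr}(Z_0Z_0^{\dagger})=1$,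 for $n=0,\dots,N-1$, $$V_n=\mathfrak{e}^{\tau A}Z_n,\quad \tilde Z_{n+1}=\left[V_n,\sqrt{\gamma_1\tau}L_1V_n,\ldots,\sqrt{\gamma_K\tau}L_KV_n\right],\quad \hat Z_{n+1}=\mathcal{T}_{tol_2}(\tilde Z_{n+1}),\quad Z_{n+1}=\frac{\hat Z_{n+1}}{\|\hat Z_{n+1}\|_F},$$ where $[\cdot,\ldots,\cdot]$ places blocks side by side. The scheme is assumed well defined, i.e. $\hat Z_{n+1}\ne0$ for all $0\le n\le N-1$. *)

theory Defs
  imports
    "HOL-Computational_Algebra.Computational_Algebra"
    "Jordan_Normal_Form.Schur_Decomposition"
begin

definition mat_trace :: "complex mat \<Rightarrow> complex" where
  "mat_trace A = (\<Sum>i<dim_row A. A $$ (i, i))"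

definition frobenius_norm :: "complex mat \<Rightarrow> real" where
  "frobenius_norm A = sqrt (\<Sum>i<dim_row A. \<Sum>j<dim_col A. (cmod (A $$ (i, j)))\<^sup>2)"

definition hermitian_mat :: "complex mat \<Rightarrow> bool" where
  "hermitian_mat A \<longleftrightarrow> mat_adjoint A = A"

definition psd_mat :: "complex mat \<Rightarrow> bool" where
  "psd_mat A \<longleftrightarrow> hermitian_mat A \<and>
     (\<forall>v \<in> carrier_vec (dim_row A). 0 \<le> Re ((A *\<^sub>v v) \<bullet>c v))"

text \<open>The square roots of the eigenvalues of \<open>Z\<^sup>\<dagger> Z\<close>, with algebraic multiplicity, in decreasing
  order.  The list has one entry per column of \<open>Z\<close>; those eigenvalues are real and nonnegative.\<close>

definition singular_value_list :: "complex mat \<Rightarrow> real list" where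
  "singular_value_list Z =
     rev (sorted_list_of_multiset
       (image_mset (\<lambda>z. sqrt (Re z)) (proots (char_poly (mat_adjoint Z * Z)))))"

text \<open>All indices are shifted by one: \<open>singular_value Z j\<close> is \<open>\<sigma>\<^bsub>j+1\<^esub>(Z)\<close>.\<close>

definition singular_value :: "complex mat \<Rightarrow> nat \<Rightarrow> real" where
  "singular_value Z j =
     (if j < min (dim_row Z) (dim_col Z) then singular_value_list Z ! j else 0)"

definition trace_norm :: "complex mat \<Rightarrow> real" where
  "trace_norm A = (\<Sum>j<min (dim_row A) (dim_col A). singular_value A j)"

definition orthonormal_fam :: "nat \<Rightarrow> nat \<Rightarrow> (nat \<Rightarrow> complex vec) \<Rightarrow> bool" where
  "orthonormal_fam d k u \<longleftrightarrow>
     (\<forall>j<k. u j \<in> carrier_vec d) \<and>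
     (\<forall>i<k. \<forall>j<k. u i \<bullet>c u j = (if i = j then 1 else 0))"

text \<open>The sum of \<open>\<sigma>\<^sub>j u\<^sub>j v\<^sub>j\<^sup>\<dagger>\<close> over the first \<open>r\<close> indices.\<close>

definition svd_partial_sum ::
  "complex mat \<Rightarrow> (nat \<Rightarrow> complex vec) \<Rightarrow> (nat \<Rightarrow> complex vec) \<Rightarrow> nat \<Rightarrow> complex mat" where
  "svd_partial_sum Z u v r =
     mat (dim_row Z) (dim_col Z)
       (\<lambda>(a, b). \<Sum>j<r. complex_of_real (singular_value Z j) * u j $ a * cnj (v j $ b))"

definition is_svd ::
  "complex mat \<Rightarrow> (nat \<Rightarrow> complex vec) \<Rightarrow> (nat \<Rightarrow> complex vec) \<Rightarrow> bool" where
  "is_svd Z u v \<longleftrightarrow>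
     (let k = min (dim_row Z) (dim_col Z) in
        orthonormal_fam (dim_row Z) k u \<and> orthonormal_fam (dim_col Z) k v \<and>
        Z = svd_partial_sum Z u v k)"

definition trunc_rank :: "real \<Rightarrow> complex mat \<Rightarrow> nat" where
  "trunc_rank tol Z = (LEAST r. (\<Sum>j\<in>{r..<dim_col Z}. (singular_value Z j)\<^sup>2) \<le> tol)"

text \<open>Column compression.  A singular value decomposition is not unique, so this is a relation
  between \<open>Z\<close> and any admissible outcome \<open>W\<close>: the truncated decomposition of \<open>Z\<close> itself, or the
  matrix with columns \<open>\<sigma>\<^sub>j u\<^sub>j\<close> in which it may be stored.\<close>

definition svd_compression :: "real \<Rightarrow> complex mat \<Rightarrow> complex mat \<Rightarrow> bool" where
  "svd_compression tol Z W \<longleftrightarrow>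
     (\<exists>u v. is_svd Z u v \<and>
        (W = svd_partial_sum Z u v (trunc_rank tol Z) \<or>
         W = mat_of_cols (dim_row Z)
               (map (\<lambda>j. complex_of_real (singular_value Z j) \<cdot>\<^sub>v u j) [0..<trunc_rank tol Z])))"

definition effective_generator ::
  "nat \<Rightarrow> nat \<Rightarrow> complex mat \<Rightarrow> (nat \<Rightarrow> complex mat) \<Rightarrow> (nat \<Rightarrow> real) \<Rightarrow> complex mat" where
  "effective_generator m K H L \<gamma> =
     mat m m (\<lambda>(a, b). - \<i> * H $$ (a, b)
       - 1 / 2 * (\<Sum>k=1..K. complex_of_real (\<gamma> k) * (mat_adjoint (L k) * L k) $$ (a, b)))"

definition lree_blocks ::
  "nat \<Rightarrow> (nat \<Rightarrow> complex mat) \<Rightarrow> (nat \<Rightarrow> real) \<Rightarrow> real \<Rightarrow> complex mat \<Rightarrow> complex mat" where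
  "lree_blocks K L \<gamma> \<tau> V =
     mat_of_cols (dim_row V)
       (concat (map cols
         (V # map (\<lambda>k. complex_of_real (sqrt (\<gamma> k * \<tau>)) \<cdot>\<^sub>m (L k * V)) [1..<Suc K])))"

text \<open>\<open>E\<close> is the matrix standing in for the exponential of \<open>\<tau> A\<close>.  The sequence \<open>Zh\<close> holds the
  compressed matrices before normalization; \<open>Zh 0\<close> is unused.\<close>

definition lree_scheme ::
  "nat \<Rightarrow> (nat \<Rightarrow> complex mat) \<Rightarrow> (nat \<Rightarrow> real) \<Rightarrow> real \<Rightarrow> real \<Rightarrow> nat \<Rightarrow> complex mat \<Rightarrow>
    (nat \<Rightarrow> complex mat) \<Rightarrow> (nat \<Rightarrow> complex mat) \<Rightarrow> bool" where
  "lree_scheme K L \<gamma> \<tau> tol N E Z Zh \<longleftrightarrow>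
     (\<forall>n<N. svd_compression tol (lree_blocks K L \<gamma> \<tau> (E * Z n)) (Zh (Suc n)) \<and>
        Z (Suc n) = complex_of_real (1 / frobenius_norm (Zh (Suc n))) \<cdot>\<^sub>m Zh (Suc n))"

end

theory Submission
  imports Defs
begin

text \<open>
  Each new density matrix is \<open>\<rho> = Z Z\<^sup>\<dagger>\<close>, where \<open>Z\<close> is a nonzero matrix divided by its Frobenius
  norm.  Every matrix of this form is Hermitian and positive semidefinite, since
  \<open>\<langle>Z Z\<^sup>\<dagger> v, v\<rangle> = \<parallel>Z\<^sup>\<dagger> v\<parallel>\<^sup>2\<close> (\<open>psd_mat_mult_adjoint\<close>), and its trace is the squared Frobenius norm of
  \<open>Z\<close>, hence \<open>1\<close> (\<open>mat_trace_mult_adjoint\<close>).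

  The remaining claim is that the trace norm of a positive semidefinite matrix is its trace
  (\<open>trace_norm_psd_mat\<close>).  Singular values are defined here through the characteristic polynomial of
  \<open>A\<^sup>\<dagger> A\<close>, which is \<open>A\<^sup>2\<close> for a Hermitian \<open>A\<close>.  Triangularizing \<open>A\<close> by a similarity also triangularizes
  \<open>A\<^sup>2\<close>, with squared diagonal entries, so the spectral theorem can be bypassed: each diagonal entry \<open>b\<close> is
  an eigenvalue of \<open>A\<close>, hence real and nonnegative, and contributes \<open>sqrt (b\<^sup>2) = b\<close> to the trace norm.
  The sum of the \<open>b\<close> is the trace of \<open>A\<close> because the trace is invariant under similarity.
\<close>

section \<open>Adjoints and positive semidefinite matrices\<close>

lemma mat_adjoint_dim [simp]:
  "dim_row (mat_adjoint A) = dim_col A" "dim_col (mat_adjoint A) = dim_row A"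
  by (simp_all add: mat_adjoint_def)

lemma mat_adjoint_index:
  fixes A :: "complex mat"
  assumes "i < dim_col A" "j < dim_row A"
  shows "mat_adjoint A $$ (i, j) = cnj (A $$ (j, i))"
  using assms by (simp add: mat_adjoint_def mat_of_rows_index)

lemma hermitian_mat_mult_adjoint: "hermitian_mat (Z * mat_adjoint Z)"
  unfolding hermitian_mat_def
proof (rule eq_matI)
  fix i j assume "i < dim_row (Z * mat_adjoint Z)" "j < dim_col (Z * mat_adjoint Z)"
  then have ij: "i < dim_row Z" "j < dim_row Z" by simp_all
  have idx: "(Z * mat_adjoint Z) $$ (a, b) = (\<Sum>l<dim_col Z. Z $$ (a, l) * cnj (Z $$ (b, l)))"
    if "a < dim_row Z" "b < dim_row Z" for a b
    using that by (simp add: scalar_prod_def mat_adjoint_index atLeast0LessThan)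
  show "mat_adjoint (Z * mat_adjoint Z) $$ (i, j) = (Z * mat_adjoint Z) $$ (i, j)"
    using ij by (simp add: mat_adjoint_index idx mult.commute del: index_mult_mat(1))
qed simp_all

lemma cscalar_prod_mat_adjoint:
  fixes A :: "complex mat"
  assumes A: "A \<in> carrier_mat n k" and v: "v \<in> carrier_vec k" and w: "w \<in> carrier_vec n"
  shows "(A *\<^sub>v v) \<bullet>c w = v \<bullet>c (mat_adjoint A *\<^sub>v w)"
proof -
  have "(A *\<^sub>v v) \<bullet>c w = (\<Sum>i<n. \<Sum>j<k. A $$ (i, j) * v $ j * cnj (w $ i))"
    using A v w by (auto simp: scalar_prod_def sum_distrib_right atLeast0LessThan intro!: sum.cong)
  also have "\<dots> = (\<Sum>j<k. \<Sum>i<n. A $$ (i, j) * v $ j * cnj (w $ i))"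
    by (rule sum.swap)
  also have "\<dots> = v \<bullet>c (mat_adjoint A *\<^sub>v w)"
    using A v w by (auto simp: scalar_prod_def sum_distrib_left atLeast0LessThan
        mat_adjoint_index ac_simps intro!: sum.cong)
  finally show ?thesis .
qed

lemma cscalar_prod_self:
  fixes v :: "complex vec"
  shows "v \<bullet>c v = complex_of_real (\<Sum>i<dim_vec v. (cmod (v $ i))\<^sup>2)"
  by (simp add: scalar_prod_def complex_norm_square atLeast0LessThan del: of_real_power)

lemma psd_mat_mult_adjoint: "psd_mat (Z * mat_adjoint Z)"
  unfolding psd_mat_def
proof (intro conjI ballI)
  fix v :: "complex vec" assume "v \<in> carrier_vec (dim_row (Z * mat_adjoint Z))"
  then have v: "v \<in> carrier_vec (dim_row Z)" by simp
  let ?w = "mat_adjoint Z *\<^sub>v v"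
  have w: "?w \<in> carrier_vec (dim_col Z)" by (intro carrier_vecI) simp
  have "(Z * mat_adjoint Z *\<^sub>v v) \<bullet>c v = (Z *\<^sub>v ?w) \<bullet>c v"
    using v by (subst assoc_mult_mat_vec[of _ "dim_row Z" "dim_col Z" _ "dim_row Z"])
      (auto intro: carrier_matI)
  also have "\<dots> = ?w \<bullet>c ?w"
    by (rule cscalar_prod_mat_adjoint[OF _ w v]) simp
  finally show "0 \<le> Re ((Z * mat_adjoint Z *\<^sub>v v) \<bullet>c v)"
    by (simp add: cscalar_prod_self sum_nonneg)
qed (rule hermitian_mat_mult_adjoint)

text \<open>For an eigenvector \<open>v\<close>, self-adjointness equates \<open>a \<parallel>v\<parallel>\<^sup>2\<close> with \<open>cnj a \<parallel>v\<parallel>\<^sup>2\<close>, so the eigenvalue is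
  real; its sign is that of the quadratic form at \<open>v\<close>.\<close>

lemma psd_mat_eigenvalue:
  assumes A: "A \<in> carrier_mat n n" and psd: "psd_mat A" and ev: "eigenvalue A a"
  shows "a = complex_of_real (Re a)" "0 \<le> Re a"
proof -
  obtain v where v: "v \<in> carrier_vec n" "v \<noteq> 0\<^sub>v n" and av: "A *\<^sub>v v = a \<cdot>\<^sub>v v"
    using ev A by (auto simp: eigenvalue_def eigenvector_def)
  define s where "s = (\<Sum>i<dim_vec v. (cmod (v $ i))\<^sup>2)"
  have s: "v \<bullet>c v = complex_of_real s"
    unfolding s_def by (rule cscalar_prod_self)
  have "v \<bullet>c v \<noteq> 0"
    using v by (simp add: conjugate_square_eq_0_vec)
  moreover have "s \<ge> 0" unfolding s_def by (simp add: sum_nonneg)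
  ultimately have s_pos: "s > 0" using s by auto
  have 1: "(A *\<^sub>v v) \<bullet>c v = a * complex_of_real s"
    using v by (simp add: av s)
  have "(A *\<^sub>v v) \<bullet>c v = v \<bullet>c (A *\<^sub>v v)"
    using cscalar_prod_mat_adjoint[OF A v(1) v(1)] psd by (simp add: psd_mat_def hermitian_mat_def)
  also have "\<dots> = cnj a * complex_of_real s"
    using v by (simp add: av conjugate_smult_vec s)
  finally have "a = cnj a" using 1 s_pos by simp
  then show "a = complex_of_real (Re a)" by (simp add: complex_eq_iff)
  have "0 \<le> Re ((A *\<^sub>v v) \<bullet>c v)" using psd v A by (auto simp: psd_mat_def)
  then show "0 \<le> Re a" using s_pos by (simp add: 1 zero_le_mult_iff)
qed

section \<open>The trace norm of a positive semidefinite matrix\<close>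

lemma mat_trace_mult_commute:
  assumes "A \<in> carrier_mat n k" "B \<in> carrier_mat k n"
  shows "mat_trace (A * B) = mat_trace (B * A)"
proof -
  have "mat_trace (A * B) = (\<Sum>i<n. \<Sum>j<k. A $$ (i, j) * B $$ (j, i))"
    using assms by (auto simp: mat_trace_def scalar_prod_def atLeast0LessThan intro!: sum.cong)
  also have "\<dots> = (\<Sum>j<k. \<Sum>i<n. A $$ (i, j) * B $$ (j, i))"
    by (rule sum.swap)
  also have "\<dots> = mat_trace (B * A)"
    using assms by (auto simp: mat_trace_def scalar_prod_def atLeast0LessThan mult.commute
        intro!: sum.cong)
  finally show ?thesis .
qed

lemma mat_trace_similar:
  assumes "similar_mat_wit A B P Q"
  shows "mat_trace A = mat_trace B"
proof -
  note w = similar_mat_witD[OF refl assms]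
  have "mat_trace A = mat_trace (P * (B * Q))"
    by (subst w(3), subst assoc_mult_mat[OF w(6,5,7)]) simp
  also have "\<dots> = mat_trace (B * Q * P)"
    by (rule mat_trace_mult_commute[OF w(6) mult_carrier_mat[OF w(5,7)]])
  also have "B * Q * P = B"
    unfolding assoc_mult_mat[OF w(5,7,6)] w(2) by (rule right_mult_one_mat[OF w(5)])
  finally show ?thesis .
qed

text \<open>A nonzero term \<open>B\<^sub>i\<^sub>l B\<^sub>l\<^sub>j\<close> forces \<open>i \<le> l \<le> j\<close>: there is none below the diagonal, and only \<open>l = i\<close> on it.\<close>

lemma upper_triangular_square:
  fixes B :: "complex mat"
  assumes B: "B \<in> carrier_mat n n" and u: "upper_triangular B"
  shows "upper_triangular (B * B)" "\<And>i. i < n \<Longrightarrow> (B * B) $$ (i, i) = (B $$ (i, i))\<^sup>2"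
proof -
  have idx: "(B * B) $$ (i, j) = (\<Sum>l<n. B $$ (i, l) * B $$ (l, j))" if "i < n" "j < n" for i j
    using that B by (auto simp: scalar_prod_def atLeast0LessThan intro!: sum.cong)
  have 0: "B $$ (i, j) = 0" if "j < i" "i < n" for i j
    using u B that by auto
  show "upper_triangular (B * B)"
  proof
    fix i j assume "j < i" "i < dim_row (B * B)"
    moreover from this have "B $$ (i, l) * B $$ (l, j) = 0" if "l < n" for l
      using that B 0[of l i] 0[of j l] by (cases "l < i") auto
    ultimately show "(B * B) $$ (i, j) = 0"
      using B by (subst idx) (auto intro!: sum.neutral simp del: mult_eq_0_iff)
  qed
  fix i assume i: "i < n"
  have "(B * B) $$ (i, i) = (\<Sum>l<n. if l = i then (B $$ (i, i))\<^sup>2 else 0)"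
    unfolding idx[OF i i]
  proof (rule sum.cong)
    fix l assume "l \<in> {..<n}"
    then show "B $$ (i, l) * B $$ (l, i) = (if l = i then (B $$ (i, i))\<^sup>2 else 0)"
      using i 0[of l i] 0[of i l] by (cases l i rule: linorder_cases) (auto simp: power2_eq_square)
  qed simp
  then show "(B * B) $$ (i, i) = (B $$ (i, i))\<^sup>2" using i by simp
qed

lemma proots_char_poly_upper_triangular:
  fixes B :: "complex mat"
  assumes "B \<in> carrier_mat n n" "upper_triangular B"
  shows "proots (char_poly B) = mset (diag_mat B)"
proof -
  have "proots (\<Prod>a\<leftarrow>xs. [:- a, 1:]) = mset xs" for xs :: "complex list"
  proof (induction xs)
    case (Cons a xs)
    have "(\<Prod>a\<leftarrow>xs. [:- a, 1:]) \<noteq> (0 :: complex poly)"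
      by (auto simp: prod_list_zero_iff)
    then show ?case using Cons by (simp add: proots_mult del: mult_pCons_left)
  qed simp
  then show ?thesis by (simp add: char_poly_upper_triangular[OF assms])
qed

text \<open>The content is that indexing below \<open>n\<close> exhausts the list of singular values exactly: over the complex
  numbers the characteristic polynomial splits into \<open>n\<close> linear factors.\<close>

lemma trace_norm_eq_sum_proots:
  assumes A: "A \<in> carrier_mat n n"
  shows "trace_norm A =
    (\<Sum>z\<in>#proots (char_poly (mat_adjoint A * A)). sqrt (Re z))"
proof -
  let ?M = "image_mset (\<lambda>z. sqrt (Re z)) (proots (char_poly (mat_adjoint A * A)))"
  have C: "mat_adjoint A * A \<in> carrier_mat n n" using A by (intro carrier_matI) auto
  obtain as where as: "char_poly (mat_adjoint A * A) = (\<Prod>a\<leftarrow>as. [:- a, 1:])" "length as = n"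
    using char_poly_factorized[OF C] by blast
  obtain B where B: "B \<in> carrier_mat n n" "upper_triangular B" "similar_mat (mat_adjoint A * A) B"
    using schur_decomposition_exists[OF C as(1)] by blast
  have "size (proots (char_poly (mat_adjoint A * A))) = n"
    using B by (simp add: char_poly_similar[OF B(3)] proots_char_poly_upper_triangular diag_mat_def)
  then have len: "length (singular_value_list A) = n"
    by (simp add: singular_value_list_def flip: size_mset)
  have "trace_norm A = (\<Sum>j<n. singular_value_list A ! j)"
    using A by (simp add: trace_norm_def singular_value_def)
  also have "\<dots> = sum_list (singular_value_list A)"
    by (simp add: sum_list_sum_nth len atLeast0LessThan)
  also have "\<dots> = sum_mset ?M"
    by (simp add: singular_value_list_def flip: sum_mset_sum_list)
  finally show ?thesis .
qed

text \<open>Both sides are read off one triangular form \<open>B\<close> of \<open>A\<close>: the same similarity carries \<open>A\<^sup>2\<close> to \<open>B\<^sup>2\<close>,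
  and the trace and the roots of the characteristic polynomial are similarity invariants.\<close>

lemma trace_norm_psd_mat:
  assumes A: "A \<in> carrier_mat n n" and psd: "psd_mat A"
  shows "complex_of_real (trace_norm A) = mat_trace A"
proof -
  obtain as where as: "char_poly A = (\<Prod>a\<leftarrow>as. [:- a, 1:])"
    using char_poly_factorized[OF A] by blast
  obtain B where B: "B \<in> carrier_mat n n" and u: "upper_triangular B" and sim: "similar_mat A B"
    using schur_decomposition_exists[OF A as] by blast
  from sim obtain P Q where wit: "similar_mat_wit A B P Q"
    by (auto simp: similar_mat_def)
  have ev: "B $$ (i, i) = complex_of_real (Re (B $$ (i, i))) \<and> 0 \<le> Re (B $$ (i, i))"
    if "i < n" for i
  proof -
    have "B $$ (i, i) \<in># proots (char_poly B)"
      using that B u by (auto simp: proots_char_poly_upper_triangular diag_mat_def)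
    then have "poly (char_poly B) (B $$ (i, i)) = 0"
      by (metis count_eq_zero_iff count_proots order_0I proots_0 count_empty)
    then have "eigenvalue A (B $$ (i, i))"
      by (simp add: eigenvalue_root_char_poly[OF A] char_poly_similar[OF sim])
    then show ?thesis using psd_mat_eigenvalue[OF A psd] by blast
  qed
  have "similar_mat_wit (A ^\<^sub>m 2) (B ^\<^sub>m 2) P Q"
    using wit by (rule similar_mat_wit_pow)
  moreover have "A ^\<^sub>m 2 = mat_adjoint A * A" "B ^\<^sub>m 2 = B * B"
    using A B psd by (auto simp: numeral_2_eq_2 psd_mat_def hermitian_mat_def)
  ultimately have sq: "char_poly (mat_adjoint A * A) = char_poly (B * B)"
    by (intro char_poly_similar) (auto simp: similar_mat_def)
  have BB: "B * B \<in> carrier_mat n n" using B by simp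
  have "trace_norm A = (\<Sum>z\<leftarrow>diag_mat (B * B). sqrt (Re z))"
    by (simp add: trace_norm_eq_sum_proots[OF A] sq
        proots_char_poly_upper_triangular[OF BB upper_triangular_square(1)[OF B u]]
        flip: sum_mset_sum_list)
  also have "\<dots> = (\<Sum>i<n. sqrt (Re ((B * B) $$ (i, i))))"
    using BB B by (simp add: diag_mat_def sum_list_sum_nth atLeast0LessThan del: index_mult_mat(1))
  also have "\<dots> = (\<Sum>i<n. Re (B $$ (i, i)))"
  proof (rule sum.cong)
    fix i assume "i \<in> {..<n}"
    then have i: "i < n" by simp
    have "Re ((B $$ (i, i))\<^sup>2) = (Re (B $$ (i, i)))\<^sup>2"
      using ev[OF i] by (metis Re_complex_of_real of_real_power)
    then show "sqrt (Re ((B * B) $$ (i, i))) = Re (B $$ (i, i))"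
      unfolding upper_triangular_square(2)[OF B u i] using ev[OF i] by simp
  qed simp
  finally have "complex_of_real (trace_norm A) = (\<Sum>i<n. complex_of_real (Re (B $$ (i, i))))"
    by simp
  also have "\<dots> = (\<Sum>i<n. B $$ (i, i))"
    by (rule sum.cong) (use ev in auto)
  also have "\<dots> = mat_trace B" using B by (simp add: mat_trace_def)
  also have "\<dots> = mat_trace A" using mat_trace_similar[OF wit] by simp
  finally show ?thesis .
qed

section \<open>The Frobenius norm and normalization\<close>

lemma mat_trace_mult_adjoint:
  "mat_trace (Z * mat_adjoint Z) = complex_of_real ((frobenius_norm Z)\<^sup>2)"
proof -
  have "mat_trace (Z * mat_adjoint Z) =
      (\<Sum>i<dim_row Z. \<Sum>j<dim_col Z. complex_of_real ((cmod (Z $$ (i, j)))\<^sup>2))"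
    unfolding mat_trace_def complex_norm_square
    by (simp add: scalar_prod_def mat_adjoint_index atLeast0LessThan)
  also have "\<dots> = complex_of_real ((frobenius_norm Z)\<^sup>2)"
    by (simp add: frobenius_norm_def sum_nonneg)
  finally show ?thesis .
qed

lemma frobenius_norm_eq_0_iff:
  "frobenius_norm Z = 0 \<longleftrightarrow> Z = 0\<^sub>m (dim_row Z) (dim_col Z)"
proof
  assume "frobenius_norm Z = 0"
  then have "\<forall>i<dim_row Z. \<forall>j<dim_col Z. Z $$ (i, j) = 0"
    by (auto simp: frobenius_norm_def sum_nonneg_eq_0_iff sum_nonneg)
  then show "Z = 0\<^sub>m (dim_row Z) (dim_col Z)" by (intro eq_matI) auto
next
  assume "Z = 0\<^sub>m (dim_row Z) (dim_col Z)"
  from arg_cong[OF this, of "\<lambda>M. M $$ ij" for ij]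
  have "Z $$ (i, j) = 0" if "i < dim_row Z" "j < dim_col Z" for i j
    using that by simp
  then show "frobenius_norm Z = 0" by (simp add: frobenius_norm_def)
qed

lemma frobenius_norm_smult:
  "frobenius_norm (c \<cdot>\<^sub>m Z) = cmod c * frobenius_norm Z"
proof -
  have "(\<Sum>i<dim_row Z. \<Sum>j<dim_col Z. (cmod ((c \<cdot>\<^sub>m Z) $$ (i, j)))\<^sup>2) =
      (cmod c)\<^sup>2 * (\<Sum>i<dim_row Z. \<Sum>j<dim_col Z. (cmod (Z $$ (i, j)))\<^sup>2)"
    by (simp add: sum_distrib_left norm_mult power_mult_distrib)
  then show ?thesis by (simp add: frobenius_norm_def real_sqrt_mult)
qed

text \<open>Both ways of storing the truncated decomposition keep the row dimension, although their numbers
  of columns differ; so \<open>Z Z\<^sup>\<dagger>\<close> has the same size in either case.\<close>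

lemma svd_compression_dim_row:
  "svd_compression tol Z W \<Longrightarrow> dim_row W = dim_row Z"
  by (auto simp: svd_compression_def svd_partial_sum_def)

section \<open>Positivity and trace preservation of the scheme\<close>

theorem mainTheorem5:
  fixes m K N r0 :: nat
    and T \<tau> tol :: real
    and H A :: "complex mat"
    and L :: "nat \<Rightarrow> complex mat"
    and \<gamma> :: "nat \<Rightarrow> real"
    and exp_approx :: "complex mat \<Rightarrow> complex mat"
    and Z Zh :: "nat \<Rightarrow> complex mat"
  assumes "m > 0" and "K > 0" and "N > 0" and "r0 > 0"
    and "T > 0" and "\<tau> = T / real N" and "tol > 0"
    and "H \<in> carrier_mat m m" and "hermitian_mat H"
    and "\<forall>k\<in>{1..K}. L k \<in> carrier_mat m m"
    and "\<forall>k\<in>{1..K}. \<gamma> k \<ge> 0"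
    and "A = effective_generator m K H L \<gamma>"
    and "exp_approx (complex_of_real \<tau> \<cdot>\<^sub>m A) \<in> carrier_mat m m"
    and "Z 0 \<in> carrier_mat m r0"
    and "mat_trace (Z 0 * mat_adjoint (Z 0)) = 1"
    and "lree_scheme K L \<gamma> \<tau> tol N (exp_approx (complex_of_real \<tau> \<cdot>\<^sub>m A)) Z Zh"
    and "\<forall>n<N. Zh (Suc n) \<noteq> 0\<^sub>m (dim_row (Zh (Suc n))) (dim_col (Zh (Suc n)))"
  shows "\<forall>n<N. let \<rho> = Z (Suc n) * mat_adjoint (Z (Suc n)) in
           \<rho> \<in> carrier_mat m m \<and> hermitian_mat \<rho> \<and> psd_mat \<rho> \<and>
           complex_of_real (trace_norm \<rho>) = mat_trace \<rho> \<and> mat_trace \<rho> = 1"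
proof (intro allI impI)
  fix n assume n: "n < N"
  let ?E = "exp_approx (complex_of_real \<tau> \<cdot>\<^sub>m A)"
  let ?W = "Zh (Suc n)" and ?Z = "Z (Suc n)"
  have comp: "svd_compression tol (lree_blocks K L \<gamma> \<tau> (?E * Z n)) ?W"
    and Z: "?Z = complex_of_real (1 / frobenius_norm ?W) \<cdot>\<^sub>m ?W"
    using assms(16) n by (auto simp: lree_scheme_def)
  have "dim_row ?Z = dim_row ?E"
    using svd_compression_dim_row[OF comp] by (simp add: Z lree_blocks_def)
  then have carrier: "?Z * mat_adjoint ?Z \<in> carrier_mat m m"
    using assms(13) by (intro carrier_matI) auto
  have "frobenius_norm ?W \<noteq> 0"
    using assms(17) n by (simp add: frobenius_norm_eq_0_iff)
  moreover have "frobenius_norm ?W \<ge> 0"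
    by (simp add: frobenius_norm_def sum_nonneg)
  ultimately have "frobenius_norm ?Z = 1"
    unfolding Z frobenius_norm_smult by (simp add: norm_divide)
  then have trace: "mat_trace (?Z * mat_adjoint ?Z) = 1"
    by (simp add: mat_trace_mult_adjoint)
  show "let \<rho> = ?Z * mat_adjoint ?Z in
      \<rho> \<in> carrier_mat m m \<and> hermitian_mat \<rho> \<and> psd_mat \<rho> \<and>
      complex_of_real (trace_norm \<rho>) = mat_trace \<rho> \<and> mat_trace \<rho> = 1"
    unfolding Let_def
    by (intro conjI carrier hermitian_mat_mult_adjoint psd_mat_mult_adjoint trace
        trace_norm_psd_mat[OF carrier psd_mat_mult_adjoint])
qed

end
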